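(* Let $0<p\le 1$. For all integers $L\ge 1$ and $0\le n\le L-1$, the restricted partition function in the case $q=0$ is given by $$\begin{Bmatrix}L\\ n+1\end{Bmatrix}_{p,0}=p^{L-n-1}\begin{Bmatrix}L\\ n+1\end{Bmatrix}_{1/p}.$$
   Context: Restricted partition function (two subscripts): $\Omega_{L,n}$ is the set of words $\tau=(\tau_1,\dots,\tau_L)$ with letters in $\{0,1,\hat 1\}$ containing exactly one $\hat 1$, exactly $n$ letters $1$ and $L-n-1$ letters $0$. For $\tau\in\Omega_{L,n}$ with $\tau_1=\hat 1$ set $$w(\tau)=\prod_{\substack{2\le i\le L\\ \tau_i=0}}\bigl(1+p\,m_i(\tau)+q\,n_i(\tau)\bigr),$$ where $m_i(\tau)$ (resp. $n_i(\tau)$) is the number of $1$'s among $\tau_2,\dots,\tau_{i-1}$ (resp. among $\tau_{i+1},\dots,\tau_L$), and $$\begin{Bmatrix}L\\ n+1\end{Bmatrix}_{p,q}=\sum_{\tau\in\Omega_{L,n},\ \tau_1=\hat 1}w(\tau).$$ Generalized Stirling number (one subscript): for integers $1\le k\le m$ and a real number $t$, $$\begin{Bmatrix}m\\ k\end{Bmatrix}_t=\sum_{P}t^{\,b(P)-1},$$ where $P$ ranges over all set partitions of $\{1,\dots,m\}$ into exactly $k$ nonempty parts and $b(P)$ is the number of elements of the part of $P$ containing $1$. *)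

theory Defs
  imports Complex_Main "HOL-Library.Disjoint_Sets"
begin

datatype letter = Zero | One | HatOne

definition Omega :: "nat \<Rightarrow> nat \<Rightarrow> letter list set" where
  "Omega L n = {\<tau>. length \<tau> = L \<and> count_list \<tau> HatOne = 1 \<and>
     count_list \<tau> One = n \<and> count_list \<tau> Zero = L - n - 1}"

text \<open>
  Lists are indexed from 0, so the letter \<open>\<tau>\<^sub>i\<close> of the literature is \<open>\<tau> ! (i - 1)\<close>.
  The leading \<open>HatOne\<close> sits at index 0, and the indices below run over \<open>{1..<length \<tau>}\<close>.
\<close>

definition ones_before :: "letter list \<Rightarrow> nat \<Rightarrow> nat" where
  "ones_before \<tau> i = card {j. 1 \<le> j \<and> j < i \<and> \<tau> ! j = One}"

definition ones_after :: "letter list \<Rightarrow> nat \<Rightarrow> nat" where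
  "ones_after \<tau> i = card {j. i < j \<and> j < length \<tau> \<and> \<tau> ! j = One}"

definition weight :: "real \<Rightarrow> real \<Rightarrow> letter list \<Rightarrow> real" where
  "weight p q \<tau> = (\<Prod>i | 1 \<le> i \<and> i < length \<tau> \<and> \<tau> ! i = Zero.
     1 + p * real (ones_before \<tau> i) + q * real (ones_after \<tau> i))"

text \<open>
  The symbol with two subscripts \<open>p\<close>, \<open>q\<close>, upper entry \<open>L\<close> and lower entry \<open>k = n + 1\<close>;
  it is meaningful for \<open>1 \<le> k \<le> L\<close> only.
\<close>

definition restricted_partition_function :: "real \<Rightarrow> real \<Rightarrow> nat \<Rightarrow> nat \<Rightarrow> real" where
  "restricted_partition_function p q L k =
     (\<Sum>\<tau> | \<tau> \<in> Omega L (k - 1) \<and> \<tau> ! 0 = HatOne. weight p q \<tau>)"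

definition block_of_1 :: "nat set set \<Rightarrow> nat set" where
  "block_of_1 P = (THE B. B \<in> P \<and> 1 \<in> B)"

definition gen_Stirling :: "real \<Rightarrow> nat \<Rightarrow> nat \<Rightarrow> real" where
  "gen_Stirling t m k =
     (\<Sum>P | partition_on {1..m} P \<and> card P = k. t ^ (card (block_of_1 P) - 1))"

end

(*
  Both sides obey the same recursion in L. Deleting the last letter of a word removes a factor
  1 + p n if that letter is 0, and no factor if it is 1, because q = 0 makes the letters to the
  right of a 0 irrelevant. Deleting the largest element of a set partition into k + 1 blocks
  removes either a singleton block or an element of one of the k + 1 blocks of a partition; of
  these, the block of 1 contributes a factor t and the k others a factor 1. With t = 1/p the
  extra power of p that comes with each increase of L turns t + n into 1 + p n.
*)
theory Submission
  imports Defs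
begin

section \<open>Words that start with \<open>HatOne\<close>, split by their last letter\<close>

lemma length_eq_count_letters:
  "length \<tau> = count_list \<tau> HatOne + count_list \<tau> One + count_list \<tau> Zero"
proof (induction \<tau>)
  case (Cons x \<tau>)
  then show ?case by (cases x) auto
qed simp

lemma Omega_eq:
  "Omega L n = {\<tau>. length \<tau> = L \<and> count_list \<tau> HatOne = 1 \<and> count_list \<tau> One = n}"
  unfolding Omega_def using length_eq_count_letters by force

lemma finite_Omega: "finite (Omega L n)"
proof -
  have "x \<in> {Zero, One, HatOne}" for x
    by (cases x) auto
  then have "finite (UNIV :: letter set)"
    by (intro finite_subset[of UNIV "{Zero, One, HatOne}"]) blast+
  then have "finite {\<tau> :: letter list. set \<tau> \<subseteq> UNIV \<and> length \<tau> = L}"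
    by (rule finite_lists_length_eq)
  then show ?thesis
    by (rule rev_finite_subset) (auto simp: Omega_def)
qed

text \<open>For \<open>1 \<le> L\<close> the leading \<open>HatOne\<close> survives deletion of the
  last letter. The conjunct \<open>n \<noteq> 0\<close> empties the second set at
  \<open>n = 0\<close>, where the truncated \<open>n - 1\<close> would otherwise let in words
  without \<open>One\<close>.\<close>

lemma Omega_Suc_HatOne_first:
  assumes "1 \<le> L"
  shows "{\<tau> \<in> Omega (Suc L) n. \<tau> ! 0 = HatOne} =
    (\<lambda>\<tau>. \<tau> @ [Zero]) ` {\<tau> \<in> Omega L n. \<tau> ! 0 = HatOne} \<union>
    (\<lambda>\<tau>. \<tau> @ [One]) ` {\<tau> \<in> Omega L (n - 1). \<tau> ! 0 = HatOne \<and> n \<noteq> 0}"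
    (is "?A = ?B")
proof
  show "?A \<subseteq> ?B"
  proof
    fix \<tau> assume A: "\<tau> \<in> ?A"
    then have "length \<tau> = Suc L" by (simp add: Omega_eq)
    then obtain \<sigma> x where \<tau>: "\<tau> = \<sigma> @ [x]" and len: "length \<sigma> = L"
      by (metis length_Suc_conv_rev)
    have "\<sigma> ! 0 = HatOne"
      using A assms \<tau> len by (simp add: nth_append)
    \<comment> \<open>The single \<open>HatOne\<close> already lies in \<open>\<sigma>\<close>, so
      \<open>x\<close> can only be \<open>Zero\<close> or \<open>One\<close>.\<close>
    then have "count_list \<sigma> HatOne \<noteq> 0"
      using assms len by (metis count_list_0_iff nth_mem One_nat_def Suc_le_eq)
    then show "\<tau> \<in> ?B"
      using A \<tau> len \<open>\<sigma> ! 0 = HatOne\<close> by (cases x) (auto simp: Omega_eq)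
  qed
  show "?B \<subseteq> ?A"
    using assms by (auto simp: Omega_eq nth_append)
qed

section \<open>Weights at \<open>q = 0\<close> and the recursion of the restricted partition
  function\<close>

lemma ones_before_append:
  "i \<le> length \<tau> \<Longrightarrow> ones_before (\<tau> @ \<sigma>) i = ones_before \<tau> i"
  unfolding ones_before_def by (rule arg_cong[where f = card]) (auto simp: nth_append)

text \<open>\<open>ones_before\<close> skips index 0, so it agrees with the full count only when no
  \<open>One\<close> sits there.\<close>

lemma ones_before_length:
  assumes "\<tau> ! 0 \<noteq> One"
  shows "ones_before \<tau> (length \<tau>) = count_list \<tau> One"
proof -
  have "ones_before \<tau> (length \<tau>) = card {j. j < length \<tau> \<and> \<tau> ! j = One}"
    unfolding ones_before_def using assms
    by (intro arg_cong[where f = card]) (auto simp: Suc_le_eq intro: gr0I)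
  then show ?thesis
    by (simp add: count_list_eq_length_filter length_filter_conv_card eq_commute)
qed

lemma weight_0_snoc_One:
  "weight p 0 (\<tau> @ [One]) = weight p 0 \<tau>"
proof -
  have "{i. 1 \<le> i \<and> i < length (\<tau> @ [One]) \<and> (\<tau> @ [One]) ! i = Zero} =
      {i. 1 \<le> i \<and> i < length \<tau> \<and> \<tau> ! i = Zero}"
    by (auto simp: nth_append less_Suc_eq)
  then show ?thesis
    unfolding weight_def by (intro prod.cong) (auto simp: ones_before_append)
qed

text \<open>The new \<open>Zero\<close> adds the index \<open>length \<tau>\<close> to the product,
  and every \<open>One\<close> of \<open>\<tau>\<close> lies before it. Since
  \<open>\<tau> \<noteq> []\<close>, this index is at least 1 and is counted by
  \<open>weight\<close>.\<close>

lemma weight_0_snoc_Zero: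
  assumes "\<tau> \<noteq> []" "\<tau> ! 0 \<noteq> One"
  shows "weight p 0 (\<tau> @ [Zero]) = (1 + p * real (count_list \<tau> One)) * weight p 0 \<tau>"
proof -
  let ?I = "{i. 1 \<le> i \<and> i < length \<tau> \<and> \<tau> ! i = Zero}"
  have "{i. 1 \<le> i \<and> i < length (\<tau> @ [Zero]) \<and> (\<tau> @ [Zero]) ! i = Zero} =
      insert (length \<tau>) ?I"
    using assms(1) by (auto simp: nth_append less_Suc_eq Suc_le_eq)
  then show ?thesis
    unfolding weight_def
    by (auto simp: ones_before_append ones_before_length[OF assms(2)] intro!: prod.cong)
qed

text \<open>The case \<open>n = 0\<close> is set apart because the lower entry 0 is not a zero value
  here: \<open>k - 1\<close> truncates, so it gives the same sum as the lower entry 1.\<close>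

lemma restricted_partition_function_Suc:
  assumes "1 \<le> L"
  shows "restricted_partition_function p 0 (Suc L) (Suc n) =
    (if n = 0 then 0 else restricted_partition_function p 0 L n) +
    (1 + p * real n) * restricted_partition_function p 0 L (Suc n)"
proof -
  let ?W = "\<lambda>m. {\<tau> \<in> Omega L m. \<tau> ! 0 = HatOne}"
  let ?W1 = "{\<tau> \<in> Omega L (n - 1). \<tau> ! 0 = HatOne \<and> n \<noteq> 0}"
  have "restricted_partition_function p 0 (Suc L) (Suc n) =
      (\<Sum>\<tau> \<in> ?W n. weight p 0 (\<tau> @ [Zero])) + (\<Sum>\<tau> \<in> ?W1. weight p 0 (\<tau> @ [One]))"
    unfolding restricted_partition_function_def
    by (simp add: Omega_Suc_HatOne_first[OF assms, unfolded One_nat_def], subst sum.union_disjoint)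
       (auto simp: finite_Omega sum.reindex inj_on_def)
  moreover have "(\<Sum>\<tau> \<in> ?W n. weight p 0 (\<tau> @ [Zero])) =
      (1 + p * real n) * restricted_partition_function p 0 L (Suc n)"
    unfolding restricted_partition_function_def sum_distrib_left
  proof (rule sum.cong)
    fix \<tau> assume "\<tau> \<in> {\<tau> \<in> Omega L (Suc n - 1). \<tau> ! 0 = HatOne}"
    then have "\<tau> \<noteq> []" "\<tau> ! 0 \<noteq> One" "count_list \<tau> One = n"
      using assms by (auto simp: Omega_eq)
    then show "weight p 0 (\<tau> @ [Zero]) = (1 + p * real n) * weight p 0 \<tau>"
      using weight_0_snoc_Zero by blast
  qed simp
  moreover have "(\<Sum>\<tau> \<in> ?W1. weight p 0 (\<tau> @ [One])) =
      (if n = 0 then 0 else restricted_partition_function p 0 L n)"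
    unfolding restricted_partition_function_def by (simp add: weight_0_snoc_One)
  ultimately show ?thesis by simp
qed

lemma restricted_partition_function_1:
  "restricted_partition_function p q (Suc 0) (Suc n) = (if n = 0 then 1 else 0)"
proof -
  have "{\<tau> \<in> Omega (Suc 0) n. \<tau> ! 0 = HatOne} = (if n = 0 then {[HatOne]} else {})"
    by (auto simp: Omega_eq length_Suc_conv)
  moreover have "weight p q [HatOne] = 1"
    unfolding weight_def by (rule prod.neutral) auto
  ultimately show ?thesis
    by (simp add: restricted_partition_function_def)
qed

section \<open>Blocks of set partitions, and adding or removing one element\<close>

lemma partition_on_block_unique:
  assumes "partition_on A P" "B \<in> P" "C \<in> P" "x \<in> B" "x \<in> C"
  shows "B = C"
  using disjointD[OF partition_onD2[OF assms(1)] assms(2,3)] assms(4,5) by blast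

lemma the_block_eq:
  assumes "partition_on A P" "B \<in> P" "x \<in> B"
  shows "(THE C. C \<in> P \<and> x \<in> C) = B"
proof (rule the_equality)
  show "B \<in> P \<and> x \<in> B" using assms by simp
  show "C = B" if "C \<in> P \<and> x \<in> C" for C
    using partition_on_block_unique[OF assms(1) _ assms(2) _ assms(3)] that by simp
qed

lemma block_of_1_eq:
  assumes "partition_on A P" "B \<in> P" "1 \<in> B"
  shows "block_of_1 P = B"
  unfolding block_of_1_def using assms by (rule the_block_eq)

text \<open>Writing \<open>P\<close> as \<open>insert B (P - {B})\<close> lets
  \<open>partition_on_insert\<close> be read from right to left.\<close>

lemma partition_on_remove_block:
  assumes "partition_on A P" "B \<in> P"
  shows "disjnt B (\<Union> (P - {B}))" and "partition_on (A - B) (P - {B})"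
proof -
  show disj: "disjnt B (\<Union> (P - {B}))"
    using partition_onD2[OF assms(1)] assms(2) by (auto simp: disjoint_def disjnt_def)
  have "partition_on A (insert B (P - {B}))"
    using assms by (simp add: insert_absorb)
  then show "partition_on (A - B) (P - {B})"
    using partition_on_insert[OF disj] by blast
qed

text \<open>Common source of the next two lemmas: \<open>C = insert a B\<close> adds an element to a
  block, \<open>C = B - {a}\<close> takes one away.\<close>

lemma partition_on_replace_block:
  assumes "partition_on A P" "B \<in> P" "C \<noteq> {}" "disjnt C (A - B)"
  shows "partition_on (A - B \<union> C) (insert C (P - {B}))"
proof -
  have "\<Union> (P - {B}) = A - B"
    using partition_onD1[OF partition_on_remove_block(2)[OF assms(1,2)]] by simp
  moreover have "A - B \<union> C - C = A - B"
    using assms(4) by (auto simp: disjnt_def)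
  ultimately show ?thesis
    using partition_on_insert[of C "P - {B}"] partition_on_remove_block(2)[OF assms(1,2)] assms(3,4)
    by simp
qed

lemma partition_on_insert_into_block:
  assumes "a \<notin> A" "partition_on A Q" "B \<in> Q"
  shows "partition_on (insert a A) (insert (insert a B) (Q - {B}))"
proof -
  have "B \<subseteq> A" using assms partition_onD1 by blast
  then have "A - B \<union> insert a B = insert a A" "disjnt (insert a B) (A - B)"
    using assms(1) by (auto simp: disjnt_def)
  then show ?thesis
    using partition_on_replace_block[OF assms(2,3), of "insert a B"] by simp
qed

text \<open>\<open>C \<noteq> {a}\<close> keeps the shrunken block nonempty. It is new to
  \<open>P\<close> because it shares a point with \<open>C\<close> but lacks \<open>a\<close>; this
  keeps the number of blocks unchanged.\<close>

lemma partition_on_remove_from_block: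
  assumes "a \<notin> A" "partition_on (insert a A) P" "C \<in> P" "a \<in> C" "C \<noteq> {a}"
  shows "partition_on A (insert (C - {a}) (P - {C}))" and "C - {a} \<notin> P"
proof -
  have "C \<subseteq> insert a A" using assms partition_onD1 by blast
  then have "insert a A - C \<union> (C - {a}) = A" "disjnt (C - {a}) (insert a A - C)"
    using assms(1,4) by (auto simp: disjnt_def)
  moreover have ne: "C - {a} \<noteq> {}" using assms(4,5) by blast
  ultimately show "partition_on A (insert (C - {a}) (P - {C}))"
    using partition_on_replace_block[OF assms(2,3), of "C - {a}"] by simp
  obtain x where "x \<in> C - {a}" using ne by blast
  then show "C - {a} \<notin> P"
    using partition_on_block_unique[OF assms(2,3), of "C - {a}" x] assms(4) by blast
qed

text \<open>The pair can be recovered from its image: \<open>B\<close> is the unique block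
  containing \<open>a\<close>, stripped of \<open>a\<close>. Excluding \<open>{a}\<close> as a block
  keeps this \<open>B\<close> nonempty.\<close>

lemma bij_betw_partition_on_insert_into_block:
  assumes "finite A" "a \<notin> A"
  shows "bij_betw (\<lambda>(Q, B). insert (insert a B) (Q - {B}))
    (SIGMA Q : {Q. partition_on A Q \<and> card Q = k}. Q)
    {P. partition_on (insert a A) P \<and> card P = k \<and> {a} \<notin> P}"
    (is "bij_betw ?f ?S ?T")
proof -
  define block where "block P = (THE C. C \<in> P \<and> a \<in> C)" for P
  let ?g = "\<lambda>P. (insert (block P - {a}) (P - {block P}), block P - {a})"
  have block: "block P = C" if "partition_on (insert a A) P" "C \<in> P" "a \<in> C" for P C
    unfolding block_def using that by (rule the_block_eq)
  have block_ex: "block P \<in> P" "a \<in> block P" "block P \<noteq> {a}" if P: "P \<in> ?T" for P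
  proof -
    have "a \<in> \<Union> P" using P partition_onD1[of "insert a A" P] by auto
    then obtain C where "C \<in> P" "a \<in> C" by blast
    then show "block P \<in> P" "a \<in> block P" "block P \<noteq> {a}"
      using block[of P C] P by auto
  qed
  have notin: "insert a B \<notin> Q" "a \<notin> B" "B \<noteq> {}" if "partition_on A Q" "B \<in> Q" for Q B
    using that assms(2) partition_onD1[OF that(1)] partition_onD3[OF that(1)] by auto
  show ?thesis
  proof (rule bij_betw_byWitness[where f' = ?g])
    show "\<forall>x \<in> ?S. ?g (?f x) = x"
    proof
      fix x assume "x \<in> ?S"
      then obtain Q B where x: "x = (Q, B)" and *: "partition_on A Q" "B \<in> Q" by auto
      have "block (insert (insert a B) (Q - {B})) = insert a B"
        by (rule block[OF partition_on_insert_into_block[OF assms(2) *]]) auto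
      then show "?g (?f x) = x"
        using notin[OF *] * x by (simp add: insert_absorb)
    qed
    show "\<forall>P \<in> ?T. ?f (?g P) = P"
    proof
      fix P assume P: "P \<in> ?T"
      \<comment> \<open>Otherwise \<open>?f\<close> would delete a block that \<open>P\<close>
        itself possesses.\<close>
      have "block P - {a} \<notin> P"
        by (rule partition_on_remove_from_block(2)[OF assms(2)]) (use P block_ex[OF P] in auto)
      then show "?f (?g P) = P"
        using block_ex[OF P] by (simp add: insert_absorb)
    qed
    show "?f ` ?S \<subseteq> ?T"
    proof (rule image_subsetI)
      fix x assume "x \<in> ?S"
      then obtain Q B where x: "x = (Q, B)" and *: "partition_on A Q" "card Q = k" "B \<in> Q" by auto
      \<comment> \<open>\<open>insert a B\<close> contains \<open>a\<close>, so it is not in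
        \<open>Q\<close>, and exchanging it for \<open>B\<close> preserves the number of
        blocks.\<close>
      have "card (insert (insert a B) (Q - {B})) = card Q"
        using notin[OF *(1,3)] finite_elements[OF assms(1) *(1)] * card_Suc_Diff1[of Q B] by simp
      moreover have "{a} \<notin> Q"
        using notin(2)[OF *(1), of "{a}"] by blast
      moreover have "{a} \<noteq> insert a B"
        using notin[OF *(1,3)] by blast
      ultimately show "?f x \<in> ?T"
        using partition_on_insert_into_block[OF assms(2) *(1,3)] x *(2) by simp
    qed
    show "?g ` ?T \<subseteq> ?S"
    proof (rule image_subsetI)
      fix P assume P: "P \<in> ?T"
      then have PA: "partition_on (insert a A) P" and cP: "card P = k" by auto
      note rem = partition_on_remove_from_block[OF assms(2) PA block_ex[OF P]]
      have "finite P" using PA finite_elements assms(1) by blast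
      then have "card (insert (block P - {a}) (P - {block P})) = card P"
        using rem(2) block_ex(1)[OF P] card_Suc_Diff1[of P "block P"] by simp
      then show "?g P \<in> ?S"
        using rem(1) cP by simp
    qed
  qed
qed

text \<open>The inverse drops \<open>{a}\<close>. The count changes by exactly one because
  \<open>a \<notin> A\<close> keeps \<open>{a}\<close> out of \<open>Q\<close>.\<close>

lemma bij_betw_partition_on_insert_singleton:
  assumes "finite A" "a \<notin> A"
  shows "bij_betw (insert {a}) {Q. partition_on A Q \<and> card Q = k}
    {P. partition_on (insert a A) P \<and> card P = Suc k \<and> {a} \<in> P}"
    (is "bij_betw _ ?S ?T")
proof (rule bij_betw_byWitness[where f' = "\<lambda>P. P - {{a}}"])
  have fin: "finite P" if "partition_on B P" "finite B" for P and B :: "'a set"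
    using that finite_elements by blast
  have notin: "{a} \<notin> Q" if "partition_on A Q" for Q
    using that assms(2) unfolding partition_on_def by blast
  show "\<forall>Q \<in> ?S. insert {a} Q - {{a}} = Q" using notin by auto
  show "\<forall>P \<in> ?T. insert {a} (P - {{a}}) = P" by auto
  show "insert {a} ` ?S \<subseteq> ?T"
  proof (rule image_subsetI)
    fix Q assume Q: "Q \<in> ?S"
    have "disjnt {a} (\<Union> Q)"
      using Q assms(2) partition_onD1 by (auto simp: disjnt_def)
    then have "partition_on (insert a A) (insert {a} Q)"
      using Q assms(2) by (simp add: partition_on_insert)
    moreover have "finite Q" "{a} \<notin> Q" using Q notin fin assms(1) by auto
    ultimately show "insert {a} Q \<in> ?T" using Q by simp
  qed
  show "(\<lambda>P. P - {{a}}) ` ?T \<subseteq> ?S"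
  proof (rule image_subsetI)
    fix P assume P: "P \<in> ?T"
    then have "partition_on A (P - {{a}})"
      using partition_on_remove_block(2)[of "insert a A" P "{a}"] assms(2) by simp
    then show "P - {{a}} \<in> ?S" using P fin assms(1) by auto
  qed
qed

section \<open>Recursion and boundary values of the generalized Stirling numbers\<close>

lemma gen_Stirling_Suc:
  assumes "1 \<le> m"
  shows "gen_Stirling t (Suc m) (Suc k) =
    gen_Stirling t m k + (t + real k) * gen_Stirling t m (Suc k)"
proof -
  let ?a = "Suc m" and ?A = "{1..m}"
  let ?S = "\<lambda>k. {Q. partition_on ?A Q \<and> card Q = k}"
  let ?T = "{P. partition_on (insert ?a ?A) P \<and> card P = Suc k}"
  let ?T1 = "{P. partition_on (insert ?a ?A) P \<and> card P = Suc k \<and> {?a} \<in> P}"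
  let ?T2 = "{P. partition_on (insert ?a ?A) P \<and> card P = Suc k \<and> {?a} \<notin> P}"
  let ?w = "\<lambda>P. t ^ (card (block_of_1 P) - 1)"
  have a: "?a \<notin> ?A" and finA: "finite ?A" by auto
  have finT: "finite ?T" and finS: "finite (?S j)" for j
    by (rule finite_subset[OF _ finitely_many_partition_on[of "insert ?a ?A"]], auto,
        rule finite_subset[OF _ finitely_many_partition_on[of "?A"]], auto)
  have block: "\<exists>C. C \<in> Q \<and> 1 \<in> C \<and> C \<subseteq> ?A" if "partition_on ?A Q" for Q
  proof -
    have "1 \<in> \<Union>Q" "\<Union>Q = ?A" using that assms unfolding partition_on_def by auto
    then show ?thesis by blast
  qed
  \<comment> \<open>The block of 1 in \<open>Q\<close> is still a block after the singleton is
    added.\<close>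
  have w1: "?w (insert {?a} Q) = ?w Q" if Q: "Q \<in> ?S k" for Q
  proof -
    obtain C where C: "C \<in> Q" "1 \<in> C" using Q block by blast
    have "partition_on (insert ?a ?A) (insert {?a} Q)"
      using bij_betw_partition_on_insert_singleton[OF finA a, of k] Q
      unfolding bij_betw_def by blast
    then show ?thesis
      using block_of_1_eq[of _ Q C] block_of_1_eq[of _ "insert {?a} Q" C] C Q by auto
  qed
  have w2: "(\<Sum>B \<in> Q. ?w (insert (insert ?a B) (Q - {B}))) = (t + real k) * ?w Q"
    if Q: "Q \<in> ?S (Suc k)" for Q
  proof -
    have PQ: "partition_on ?A Q" and cQ: "card Q = Suc k" using Q by auto
    obtain C where C: "C \<in> Q" "1 \<in> C" "C \<subseteq> ?A" using PQ block by blast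
    have bQ: "block_of_1 Q = C" using block_of_1_eq PQ C by blast
    have finQ: "finite Q" using cQ card_ge_0_finite by force
    have finC: "finite C" using C finite_subset by blast
    \<comment> \<open>With \<open>C\<close> nonempty the subtraction in the exponent
      \<open>card C - 1\<close> does not truncate, so enlarging \<open>C\<close> multiplies the
      weight by exactly \<open>t\<close>.\<close>
    have "card C \<noteq> 0" "?a \<notin> C" using C finC by auto
    moreover have "block_of_1 (insert (insert ?a C) (Q - {C})) = insert ?a C"
      using block_of_1_eq[OF partition_on_insert_into_block[OF a PQ C(1)]] C by auto
    ultimately have wC: "?w (insert (insert ?a C) (Q - {C})) = t * ?w Q"
      using finC bQ by (cases "card C") auto
    \<comment> \<open>Enlarging one of the \<open>k\<close> other blocks leaves \<open>C\<close>
      untouched as the block of 1.\<close>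
    have "?w (insert (insert ?a B) (Q - {B})) = ?w Q" if "B \<in> Q - {C}" for B
    proof -
      have "block_of_1 (insert (insert ?a B) (Q - {B})) = C"
        using block_of_1_eq[OF partition_on_insert_into_block[OF a PQ, of B], of C] that C by auto
      then show ?thesis using bQ by simp
    qed
    then have "(\<Sum>B \<in> Q - {C}. ?w (insert (insert ?a B) (Q - {B}))) = real k * ?w Q"
      using cQ C finQ by simp
    then show ?thesis
      using wC C finQ by (subst sum.remove[of _ C]) (auto simp: algebra_simps)
  qed
  have "gen_Stirling t (Suc m) (Suc k) = sum ?w ?T"
    unfolding gen_Stirling_def by (simp add: atLeastAtMostSuc_conv)
  also have "?T = ?T1 \<union> ?T2" by auto
  also have "sum ?w (?T1 \<union> ?T2) = sum ?w ?T1 + sum ?w ?T2"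
    by (rule sum.union_disjoint) (auto intro: finite_subset[OF _ finT])
  also have "sum ?w ?T1 = (\<Sum>Q \<in> ?S k. ?w (insert {?a} Q))"
    using sum.reindex_bij_betw[OF bij_betw_partition_on_insert_singleton[OF finA a]] by (rule sym)
  also have "\<dots> = gen_Stirling t m k"
    unfolding gen_Stirling_def by (rule sum.cong[OF refl w1])
  also have "sum ?w ?T2 = (\<Sum>(Q, B) \<in> (SIGMA Q : ?S (Suc k). Q). ?w (insert (insert ?a B) (Q - {B})))"
    using sum.reindex_bij_betw[OF bij_betw_partition_on_insert_into_block[OF finA a], of ?w, symmetric]
    by (simp add: case_prod_unfold)
  also have "\<dots> = (\<Sum>Q \<in> ?S (Suc k). \<Sum>B \<in> Q. ?w (insert (insert ?a B) (Q - {B})))"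
    by (rule sum.Sigma[symmetric]) (use finS finite_elements[OF finA] in auto)
  also have "\<dots> = (t + real k) * gen_Stirling t m (Suc k)"
    unfolding gen_Stirling_def sum_distrib_left by (rule sum.cong[OF refl w2])
  finally show ?thesis .
qed

lemma gen_Stirling_0:
  assumes "1 \<le> m"
  shows "gen_Stirling t m 0 = 0"
proof -
  have "card P \<noteq> 0" if "partition_on {1..m} P" for P
  proof -
    \<comment> \<open>Infinite sets also have \<open>card\<close> 0, so finiteness has to be
      established first.\<close>
    have "finite P" using that finite_elements by blast
    moreover have "P \<noteq> {}" using that assms unfolding partition_on_def by auto
    ultimately show ?thesis by simp
  qed
  then have "{P. partition_on {1..m} P \<and> card P = 0} = {}" by blast
  then show ?thesis unfolding gen_Stirling_def by (simp only: sum.empty)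
qed

lemma gen_Stirling_1:
  "gen_Stirling t (Suc 0) (Suc k) = (if k = 0 then 1 else 0)"
proof -
  have "partition_on {1..Suc 0} P \<longleftrightarrow> P = {{1}}" for P
  proof
    assume P: "partition_on {1..Suc 0} P"
    have "B = {1}" if "B \<in> P" for B
    proof -
      have "B \<subseteq> {1}" "B \<noteq> {}"
        using that partition_onD1[OF P] partition_onD3[OF P] by auto
      then show ?thesis by blast
    qed
    moreover have "P \<noteq> {}" using partition_onD1[OF P] by auto
    ultimately show "P = {{1}}" by blast
  qed (simp add: partition_on_space)
  then have "{P. partition_on {1..Suc 0} P \<and> card P = Suc k} = {P. P = {{1}} \<and> card P = Suc k}"
    by (simp only:)
  also have "\<dots> = (if k = 0 then {{{1}}} else {})"
    by (cases k) auto
  finally have "{P. partition_on {1..Suc 0} P \<and> card P = Suc k} = (if k = 0 then {{{1}}} else {})" .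
  moreover have "block_of_1 {{1}} = {1}"
    by (rule block_of_1_eq[of "{1}"]) (simp_all add: partition_on_space)
  ultimately show ?thesis
    unfolding gen_Stirling_def by simp
qed

text \<open>There cannot be more blocks than elements; in the recursion both terms vanish by
  induction. The final induction uses this where its exponents truncate.\<close>

lemma gen_Stirling_eq_0:
  "1 \<le> m \<Longrightarrow> m \<le> k \<Longrightarrow> gen_Stirling t m (Suc k) = 0"
proof (induction m arbitrary: k rule: dec_induct)
  case base
  then show ?case by (simp add: gen_Stirling_1)
next
  case (step m)
  then show ?case by (cases k) (auto simp: gen_Stirling_Suc)
qed

section \<open>Comparison of the two recursions\<close>

theorem theorem3p7:
  fixes p :: real and L n :: nat
  assumes "0 < p" and "p \<le> 1"
    and "1 \<le> L" and "n \<le> L - 1"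
  shows "restricted_partition_function p 0 L (n + 1) =
    p ^ (L - n - 1) * gen_Stirling (1 / p) L (n + 1)"
proof -
  \<comment> \<open>Stated for every \<open>n\<close>: passing from \<open>L\<close> to
    \<open>Suc L\<close> at \<open>n = L\<close> calls on the induction hypothesis with lower entry
    \<open>Suc L\<close>, where both sides are 0.\<close>
  have "restricted_partition_function p 0 L (Suc n) =
      p ^ (L - Suc n) * gen_Stirling (1 / p) L (Suc n)"
    using \<open>1 \<le> L\<close>
  proof (induction L arbitrary: n rule: dec_induct)
    case base
    then show ?case by (simp add: restricted_partition_function_1 gen_Stirling_1)
  next
    case (step L)
    let ?S = "gen_Stirling (1 / p) L"
    have top: "(1 + p * real n) * (p ^ (L - Suc n) * ?S (Suc n)) =
        p ^ (L - n) * ((1 / p + real n) * ?S (Suc n))"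
    \<comment> \<open>For \<open>L \<le> n\<close> both exponents truncate to 0 and no extra factor
      \<open>p\<close> is available, but the Stirling number vanishes. Otherwise
      \<open>p * (1 / p + n) = 1 + p * n\<close>.\<close>
    proof (cases "L \<le> n")
      case True
      then show ?thesis using gen_Stirling_eq_0 step.hyps by simp
    next
      case False
      then have "p ^ (L - n) = p * p ^ (L - Suc n)"
        by (metis Suc_diff_Suc not_le power_Suc)
      then show ?thesis using \<open>0 < p\<close> by (simp add: field_simps)
    qed
    \<comment> \<open>At \<open>n = 0\<close> the default 0 matches \<open>gen_Stirling_0\<close>;
      for a successor this is the induction hypothesis at the predecessor of
      \<open>n\<close>.\<close>
    have "(if n = 0 then 0 else restricted_partition_function p 0 L n) = p ^ (L - n) * ?S n"
      using step by (cases n) (auto simp: gen_Stirling_0)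
    then show ?case
      using step top by (simp add: restricted_partition_function_Suc gen_Stirling_Suc ring_distribs)
  qed
  then show ?thesis by simp
qed

end
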